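(* Let $A\subseteq\mathbb{N}$, and let $E=\mathbb{N}\setminus(A+A)$. If $$D(E)<\frac{7}{32},$$ then $$\limsup_{n\to\infty} r(n)>5.$$
   Context: $\mathbb{N}$ denotes the set of positive integers. For $A\subseteq\mathbb{N}$, $A+A=\{a+b: a,b\in A\}$ and $r(n)=\#\{(a,b)\in A\times A: a+b=n\}$ is the ordered representation function of $A$. For $E\subseteq\mathbb{N}$, the upper density is $D(E)=\limsup_{n\to\infty}\frac{|E\cap\{1,2,\ldots,n\}|}{n}$. The limsup of $r(n)$ is allowed to be $+\infty$. *)

theory Defs
  imports Complex_Main "HOL-Library.Set_Algebras" "HOL-Library.Extended_Real"
begin

text \<open>The set of positive integers is written \<open>{1..}\<close> on type \<open>nat\<close>, and \<open>A + A\<close> is the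
  elementwise sum of sets from \<open>Set_Algebras\<close>. Limits superior are taken in \<open>ereal\<close>, so that
  they always exist and may be infinite.\<close>

definition rep_count :: "nat set \<Rightarrow> nat \<Rightarrow> nat" where
  "rep_count A n = card {(a, b). a \<in> A \<and> b \<in> A \<and> a + b = n}"

text \<open>The set counted in \<open>rep_count\<close> is always finite, so \<open>card\<close> is its true cardinality.\<close>

lemma finite_rep_pairs: "finite {(a, b). a \<in> A \<and> b \<in> A \<and> a + b = (n::nat)}"
  by (rule finite_subset[of _ "{..n} \<times> {..n}"]) auto

definition upper_density :: "nat set \<Rightarrow> ereal" where
  "upper_density E = limsup (\<lambda>n. ereal (real (card (E \<inter> {1..n})) / real n))"

end

theory Submission
  imports Defs "HOL-Analysis.Analysis" "HOL-Computational_Algebra.Formal_Power_Series"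
    "HOL-Real_Asymp.Real_Asymp"
begin

text \<open>
  Suppose that \<open>r(n) \<le> 5\<close> for all large \<open>n\<close>. Swapping the two summands shows that \<open>r(n)\<close> is odd
  only if \<open>n = 2a\<close> for some \<open>a \<in> A\<close>, and \<open>A\<close> has density zero because \<open>r\<close> is bounded. So for almost
  all \<open>n\<close> the value \<open>r(n)\<close> is 0, 2 or 4, and (for \<open>n \<ge> 1\<close>) it is 0 only on \<open>E\<close>. Put \<open>c = 5/2\<close>. The
  quantity \<open>(r(n) - c)\<^sup>2 - r(n)\<close> equals \<open>25/4\<close> when \<open>r(n) = 0\<close> and \<open>-7/4\<close> when \<open>r(n)\<close> is 2 or 4. If
  \<open>E\<close> has upper density at most \<open>b\<close>, its averages are therefore asymptotically at most \<open>8 b - 7/4\<close>,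
  which is negative exactly when \<open>b < 7/32\<close>.

  On the other hand these averages cannot stay below a negative constant, whatever the value of
  \<open>c \<ge> 0\<close>; this is \<open>mean_square_deviation_lower_bound\<close>. With \<open>f(z) = \<Sum>a\<in>A. z\<^sup>a\<close> one has
  \<open>f(z)\<^sup>2 = \<Sum>n. r(n) z\<^sup>n = c / (1 - z) + D(z)\<close>, where \<open>D\<close> has the coefficients \<open>r(n) - c\<close>.
  Take the mean of \<open>\<bar>f\<bar>\<^sup>2\<close> over the circle \<open>\<bar>z\<bar> = sqrt x\<close> with \<open>x < 1\<close>. By Parseval it is
  \<open>f(x) = sqrt (\<Sum>n. r(n) x\<^sup>n)\<close>, since the coefficients of \<open>f\<close> are 0 and 1. The mean of
  \<open>\<bar>1 / (1 - z)\<bar>\<close> grows only like \<open>-ln (1 - x)\<close>, and the mean of \<open>\<bar>D\<bar>\<close> is at most its quadratic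
  mean \<open>sqrt (\<Sum>n. (r(n) - c)\<^sup>2 x\<^sup>n)\<close>. The first bound is
  \<open>inv_sqrt_coeff_sum_le\<close>, and \<open>sum_squares_le_of_self_convolution\<close> combines the means.
  Multiplying by \<open>sqrt (1 - x)\<close> makes the logarithm disappear as \<open>x\<close> tends to 1 and leaves an inequality between the Abel means of \<open>r(n)\<close> and of \<open>(r(n) - c)\<^sup>2\<close>.

  The weights \<open>x\<^sup>n\<close> of Abel means fit the problem because they are multiplicative and so respect the
  product \<open>f\<^sup>2\<close>, whereas a sharp cutoff of \<open>A\<close> would distort the representation function beyond the
  cutoff. Upper density controls Abel means by \<open>abel_mean_le\<close>.
\<close>

section \<open>Parseval's identity for absolutely convergent series\<close>

lemma has_integral_cos_diff:
  fixes m n :: nat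
  shows "((\<lambda>t. cos ((real m - real n) * t)) has_integral (if m = n then 2 * pi else 0)) {0..2*pi}"
proof (cases "m = n")
  case True
  then show ?thesis using has_integral_const_real[of "1::real" 0 "2*pi"] by simp
next
  case False
  define k where "k = real m - real n"
  have k: "k \<noteq> 0" using False by (simp add: k_def)
  have "((\<lambda>t. cos (k * t)) has_integral (sin (k * (2*pi)) / k - sin (k * 0) / k)) {0..2*pi}"
    by (rule fundamental_theorem_of_calculus)
       (use k in \<open>auto intro!: derivative_eq_intros simp flip: has_real_derivative_iff_has_vector_derivative\<close>)
  moreover have "sin (k * (2*pi)) = 0"
    using sin_diff[of "real m * (2*pi)" "real n * (2*pi)"]
    by (simp add: k_def left_diff_distrib)
      (metis mult.assoc mult.commute sin_npi2 sin_double mult_zero_right mult_zero_left diff_self)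
  ultimately show ?thesis using False by (simp add: k_def)
qed

lemma norm_sq_trig_poly:
  fixes a :: "nat \<Rightarrow> real"
  shows "(cmod (\<Sum>n\<in>I. of_real (a n) * cis t ^ n))\<^sup>2
    = (\<Sum>m\<in>I. \<Sum>n\<in>I. a m * a n * cos ((real m - real n) * t))"
proof -
  have *: "(\<Sum>n\<in>I. of_real (a n) * cis t ^ n) = (\<Sum>n\<in>I. of_real (a n) * cis (real n * t))"
    by (simp add: Complex.DeMoivre)
  have "(\<Sum>m\<in>I. \<Sum>n\<in>I. a m * a n * cos ((real m - real n) * t))
      = (\<Sum>n\<in>I. a n * cos (real n * t))\<^sup>2 + (\<Sum>n\<in>I. a n * sin (real n * t))\<^sup>2"
    unfolding power2_eq_square sum_product sum.distrib[symmetric]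
    by (intro sum.cong refl) (simp add: left_diff_distrib cos_diff algebra_simps)
  then show ?thesis unfolding * by (simp only: cmod_power2 Re_sum Im_sum) simp
qed

lemma parseval_finite:
  fixes a :: "nat \<Rightarrow> real"
  assumes "finite I"
  shows "((\<lambda>t. (cmod (\<Sum>n\<in>I. of_real (a n) * cis t ^ n))\<^sup>2) has_integral
    2 * pi * (\<Sum>n\<in>I. (a n)\<^sup>2)) {0..2*pi}"
proof -
  have "((\<lambda>t. \<Sum>m\<in>I. \<Sum>n\<in>I. a m * a n * cos ((real m - real n) * t)) has_integral
    (\<Sum>m\<in>I. \<Sum>n\<in>I. a m * a n * (if m = n then 2 * pi else 0))) {0..2*pi}"
    using assms by (intro has_integral_sum has_integral_mult_right has_integral_cos_diff)
  moreover have "(\<Sum>m\<in>I. \<Sum>n\<in>I. a m * a n * (if m = n then 2 * pi else 0)) = 2 * pi * (\<Sum>n\<in>I. (a n)\<^sup>2)"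
    using assms by (simp add: sum_distrib_left power2_eq_square if_distrib sum.delta' algebra_simps cong: if_cong)
  ultimately show ?thesis by (simp add: norm_sq_trig_poly)
qed

lemma summable_square_of_summable_abs:
  fixes a :: "nat \<Rightarrow> real"
  assumes "summable (\<lambda>n. \<bar>a n\<bar>)"
  shows "summable (\<lambda>n. (a n)\<^sup>2)"
proof (rule summable_comparison_test_ev[OF _ assms])
  have "eventually (\<lambda>n. \<bar>a n\<bar> < 1) sequentially"
    using order_tendstoD(2)[OF summable_LIMSEQ_zero[OF assms], of 1] by simp
  then show "eventually (\<lambda>n. norm ((a n)\<^sup>2) \<le> \<bar>a n\<bar>) sequentially"
  proof (rule eventually_mono)
    fix n assume "\<bar>a n\<bar> < 1"
    then have "\<bar>a n\<bar> * \<bar>a n\<bar> \<le> \<bar>a n\<bar>" by (intro mult_left_le) auto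
    then show "norm ((a n)\<^sup>2) \<le> \<bar>a n\<bar>" by (simp add: power2_eq_square)
  qed
qed

text \<open>The squared moduli of the partial sums are dominated by the square of the absolute sum of the
  coefficients, so the finite identity passes to the limit by dominated convergence.\<close>

lemma parseval:
  fixes a :: "nat \<Rightarrow> real"
  assumes "summable (\<lambda>n. \<bar>a n\<bar>)"
  shows "((\<lambda>t. (cmod (\<Sum>n. of_real (a n) * cis t ^ n))\<^sup>2) has_integral
    2 * pi * (\<Sum>n. (a n)\<^sup>2)) {0..2*pi}"
proof -
  define s where "s N t = (\<Sum>n<N. of_real (a n) * cis t ^ n)" for N t
  define S where "S t = (\<Sum>n. of_real (a n) * cis t ^ n)" for t
  define T where "T = (\<Sum>n. \<bar>a n\<bar>)"
  have nrm: "cmod (of_real (a n) * cis t ^ n) = \<bar>a n\<bar>" for n t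
    by (simp add: norm_mult norm_power)
  have lim: "(\<lambda>N. s N t) \<longlonglongrightarrow> S t" for t
    unfolding s_def S_def
    by (rule summable_LIMSEQ, rule summable_norm_cancel) (simp add: nrm assms)
  have bound: "cmod (s N t) \<le> T" for N t
  proof -
    have "cmod (s N t) \<le> (\<Sum>n<N. \<bar>a n\<bar>)"
      unfolding s_def by (rule order_trans[OF norm_sum]) (simp add: nrm)
    also have "\<dots> \<le> T" unfolding T_def by (rule sum_le_suminf[OF assms]) auto
    finally show ?thesis .
  qed
  have int: "((\<lambda>t. (cmod (s N t))\<^sup>2) has_integral 2 * pi * (\<Sum>n<N. (a n)\<^sup>2)) {0..2*pi}" for N
    unfolding s_def by (rule parseval_finite) simp
  have dom: "(\<lambda>t. (cmod (S t))\<^sup>2) integrable_on {0..2*pi}"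
     "(\<lambda>N. integral {0..2*pi} (\<lambda>t. (cmod (s N t))\<^sup>2)) \<longlonglongrightarrow> integral {0..2*pi} (\<lambda>t. (cmod (S t))\<^sup>2)"
  proof -
    have i: "(\<lambda>t. (cmod (s N t))\<^sup>2) integrable_on {0..2*pi}" for N using int by blast
    have b: "norm ((cmod (s N t))\<^sup>2) \<le> T\<^sup>2" for N t using bound[of N t] by (simp add: power_mono)
    have l: "(\<lambda>N. (cmod (s N t))\<^sup>2) \<longlonglongrightarrow> (cmod (S t))\<^sup>2" for t
      by (intro tendsto_intros lim)
    have c: "(\<lambda>t::real. T\<^sup>2) integrable_on {0..2*pi}" by (rule integrable_const_ivl)
    from dominated_convergence[OF i c b l]
    show "(\<lambda>t. (cmod (S t))\<^sup>2) integrable_on {0..2*pi}"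
     "(\<lambda>N. integral {0..2*pi} (\<lambda>t. (cmod (s N t))\<^sup>2)) \<longlonglongrightarrow> integral {0..2*pi} (\<lambda>t. (cmod (S t))\<^sup>2)"
      by blast+
  qed
  have "(\<lambda>N. 2 * pi * (\<Sum>n<N. (a n)\<^sup>2)) \<longlonglongrightarrow> 2 * pi * (\<Sum>n. (a n)\<^sup>2)"
    by (rule tendsto_mult_left[OF summable_LIMSEQ[OF summable_square_of_summable_abs[OF assms]]])
  moreover have "(\<lambda>N. 2 * pi * (\<Sum>n<N. (a n)\<^sup>2)) \<longlonglongrightarrow> integral {0..2*pi} (\<lambda>t. (cmod (S t))\<^sup>2)"
    using dom(2) by (simp only: integral_unique[OF int])
  ultimately have "integral {0..2*pi} (\<lambda>t. (cmod (S t))\<^sup>2) = 2 * pi * (\<Sum>n. (a n)\<^sup>2)"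
    by (rule LIMSEQ_unique[symmetric])
  then show ?thesis using integrable_integral[OF dom(1)] unfolding S_def by (simp only:)
qed

section \<open>A mean value inequality for the square of a power series\<close>

text \<open>In terms of the functions \<open>F\<close>, \<open>H\<close>, \<open>G\<close> on the unit circle with the coefficients \<open>a\<close>, \<open>h\<close>, \<open>d\<close>,
  the hypothesis says \<open>F\<^sup>2 = c H\<^sup>2 + G\<close>. Hence \<open>\<bar>F\<bar>\<^sup>2 \<le> c \<bar>H\<bar>\<^sup>2 + \<bar>G\<bar>\<close>, and taking means turns the two
  squares into sums of squared coefficients; the mean of \<open>\<bar>G\<bar>\<close> is at most its quadratic mean.\<close>

lemma sum_squares_le_of_self_convolution:
  fixes a h d :: "nat \<Rightarrow> real"
  assumes a: "summable (\<lambda>n. \<bar>a n\<bar>)" and h: "summable (\<lambda>n. \<bar>h n\<bar>)" and d: "summable (\<lambda>n. \<bar>d n\<bar>)"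
    and c: "c \<ge> 0"
    and conv: "\<And>n. (\<Sum>i\<le>n. a i * a (n - i)) = c * (\<Sum>i\<le>n. h i * h (n - i)) + d n"
  shows "(\<Sum>n. (a n)\<^sup>2) \<le> c * (\<Sum>n. (h n)\<^sup>2) + sqrt (\<Sum>n. (d n)\<^sup>2)"
proof -
  define F where "F a t = (\<Sum>n. of_real (a n) * cis t ^ n)" for a :: "nat \<Rightarrow> real" and t
  have nrm: "cmod (of_real (a n) * cis t ^ n) = \<bar>a n\<bar>" for a n t
    by (simp add: norm_mult norm_power)
  have smb: "summable (\<lambda>n. of_real (b n) * cis t ^ n)" if "summable (\<lambda>n. \<bar>b n\<bar>)" for b :: "nat \<Rightarrow> real" and t
    by (rule summable_norm_cancel) (simp add: nrm that)
  have square: "(\<lambda>n. of_real (\<Sum>i\<le>n. b i * b (n - i)) * cis t ^ n) sums (F b t)\<^sup>2"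
    if "summable (\<lambda>n. \<bar>b n\<bar>)" for b t
  proof -
    have "(\<lambda>n. \<Sum>i\<le>n. (of_real (b i) * cis t ^ i) * (of_real (b (n - i)) * cis t ^ (n - i))) sums (F b t * F b t)"
      unfolding F_def by (rule Cauchy_product_sums) (simp_all only: nrm that)
    moreover have "(\<Sum>i\<le>n. (of_real (b i) * cis t ^ i) * (of_real (b (n - i)) * cis t ^ (n - i)))
        = of_real (\<Sum>i\<le>n. b i * b (n - i)) * cis t ^ n" for n
    proof -
      have "(of_real (b i) * cis t ^ i) * (of_real (b (n - i)) * cis t ^ (n - i))
          = of_real (b i * b (n - i)) * cis t ^ n" if "i \<le> n" for i
      proof -
        have "cis t ^ n = cis t ^ i * cis t ^ (n - i)" using that by (simp flip: power_add)
        then show ?thesis by simp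
      qed
      then have "(\<Sum>i\<le>n. (of_real (b i) * cis t ^ i) * (of_real (b (n - i)) * cis t ^ (n - i)))
          = (\<Sum>i\<le>n. of_real (b i * b (n - i)) * cis t ^ n)" by (intro sum.cong) auto
      then show ?thesis by (simp only: of_real_sum sum_distrib_right)
    qed
    ultimately show ?thesis by (simp add: power2_eq_square)
  qed
  have eq: "(F a t)\<^sup>2 = of_real c * (F h t)\<^sup>2 + F d t" for t
  proof (rule sums_unique2[OF square[OF a]])
    show "(\<lambda>n. of_real (\<Sum>i\<le>n. a i * a (n - i)) * cis t ^ n) sums (of_real c * (F h t)\<^sup>2 + F d t)"
      using sums_add[OF sums_mult[OF square[OF h, of t], of "of_real c"]
          summable_sums[OF smb[OF d, of t]]]
      by (simp add: conv F_def algebra_simps)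
  qed
  have parseval': "((\<lambda>t. (cmod (F b t))\<^sup>2) has_integral 2 * pi * (\<Sum>n. (b n)\<^sup>2)) {0..2*pi}"
    if "summable (\<lambda>n. \<bar>b n\<bar>)" for b
    unfolding F_def by (rule parseval[OF that])
  define Q where "Q = (\<Sum>n. (d n)\<^sup>2)"
  have Q0: "Q \<ge> 0" unfolding Q_def
    by (intro suminf_nonneg summable_square_of_summable_abs d) auto
  \<comment> \<open>The bound \<open>y \<le> s/2 + y\<^sup>2/(2s)\<close> for \<open>y = \<bar>G\<bar>\<close> is used under the integral and optimised
    afterwards at \<open>s = sqrt Q\<close>; this replaces the Cauchy-Schwarz inequality.\<close>
  have am_gm: "(\<Sum>n. (a n)\<^sup>2) \<le> c * (\<Sum>n. (h n)\<^sup>2) + (s / 2 + Q / (2 * s))" if s: "s > 0" for s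
  proof -
    have pt: "(cmod (F a t))\<^sup>2 \<le> c * (cmod (F h t))\<^sup>2 + (s / 2 + (cmod (F d t))\<^sup>2 / (2 * s))" for t
    proof -
      have "(cmod (F a t))\<^sup>2 = cmod (of_real c * (F h t)\<^sup>2 + F d t)"
        unfolding eq[symmetric] by (simp only: norm_power)
      also have "\<dots> \<le> c * (cmod (F h t))\<^sup>2 + cmod (F d t)"
        using c by (intro order_trans[OF norm_triangle_ineq]) (simp add: norm_mult norm_power)
      also have "cmod (F d t) \<le> s / 2 + (cmod (F d t))\<^sup>2 / (2 * s)"
        using s zero_le_power2[of "s - cmod (F d t)"]
        by (simp add: field_simps power2_eq_square)
      finally show ?thesis by simp
    qed
    have "((\<lambda>t. c * (cmod (F h t))\<^sup>2 + (s / 2 + (cmod (F d t))\<^sup>2 / (2 * s))) has_integral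
        (c * (2 * pi * (\<Sum>n. (h n)\<^sup>2)) + ((2 * pi) * (s / 2) + (2 * pi * Q) / (2 * s)))) {0..2*pi}"
      unfolding Q_def
    proof (rule has_integral_add[OF _ has_integral_add])
      show "((\<lambda>t. c * (cmod (F h t))\<^sup>2) has_integral c * (2 * pi * (\<Sum>n. (h n)\<^sup>2))) {0..2*pi}"
        by (rule has_integral_mult_right[OF parseval'[OF h]])
      show "((\<lambda>t. s / 2) has_integral 2 * pi * (s / 2)) {0..2*pi}"
        using has_integral_const_real[of "s/2" 0 "2*pi"] by simp
      show "((\<lambda>t. (cmod (F d t))\<^sup>2 / (2 * s)) has_integral 2 * pi * (\<Sum>n. (d n)\<^sup>2) / (2 * s)) {0..2*pi}"
        by (rule has_integral_divide[OF parseval'[OF d]])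
    qed
    from has_integral_le[OF parseval'[OF a] this pt]
    have "2 * pi * (\<Sum>n. (a n)\<^sup>2) \<le> 2 * pi * (c * (\<Sum>n. (h n)\<^sup>2) + (s / 2 + Q / (2 * s)))"
      by (simp add: algebra_simps)
    then show ?thesis by (rule mult_left_le_imp_le) simp
  qed
  have "(\<Sum>n. (a n)\<^sup>2) - c * (\<Sum>n. (h n)\<^sup>2) \<le> sqrt Q"
  proof (cases "Q = 0")
    case True
    have "(\<Sum>n. (a n)\<^sup>2) - c * (\<Sum>n. (h n)\<^sup>2) \<le> 0 + e" if "e > 0" for e
      using am_gm[of "2 * e"] that True by simp
    then show ?thesis unfolding True real_sqrt_zero by (rule field_le_epsilon)
  next
    case False
    with Q0 have "sqrt Q > 0" by simp
    moreover have "Q / (2 * sqrt Q) = sqrt Q / 2"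
      using real_div_sqrt[OF Q0] by (simp add: field_simps)
    ultimately show ?thesis using am_gm[of "sqrt Q"] by simp
  qed
  then show ?thesis by (simp add: Q_def)
qed

section \<open>The coefficients of the inverse square root\<close>

text \<open>These are the coefficients of \<open>h(z) = 1 / sqrt (1 - z)\<close>. Since \<open>h\<^sup>2 = 1 / (1 - z)\<close>, the mean of
  \<open>\<bar>1 / (1 - z)\<bar>\<close> over a circle is the mean of \<open>\<bar>h\<bar>\<^sup>2\<close>, which Parseval evaluates without any
  estimate of \<open>\<bar>1 - z\<bar>\<close>.\<close>

definition inv_sqrt_coeff :: "nat \<Rightarrow> real" where
  "inv_sqrt_coeff n = (- 1) ^ n * ((- 1 / 2) gchoose n)"

text \<open>The coefficient form of \<open>h\<^sup>2 = 1 / (1 - z)\<close>, an instance of Vandermonde's identity.\<close>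

lemma inv_sqrt_coeff_conv: "(\<Sum>i\<le>n. inv_sqrt_coeff i * inv_sqrt_coeff (n - i)) = 1"
proof -
  have "(\<Sum>i\<le>n. inv_sqrt_coeff i * inv_sqrt_coeff (n - i))
      = (\<Sum>i\<le>n. (- 1) ^ n * (((- 1 / 2) gchoose i) * ((- 1 / 2) gchoose (n - i))))"
  proof (rule sum.cong)
    fix i assume "i \<in> {..n}"
    then have "(- 1) ^ n = (- 1 :: real) ^ i * (- 1) ^ (n - i)" by (simp flip: power_add)
    then show "inv_sqrt_coeff i * inv_sqrt_coeff (n - i) =
        (- 1) ^ n * (((- 1 / 2) gchoose i) * ((- 1 / 2) gchoose (n - i)))"
      by (simp add: inv_sqrt_coeff_def)
  qed simp
  also have "\<dots> = (- 1) ^ n * ((- 1) gchoose n)"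
    using gbinomial_Vandermonde[of "- 1 / 2 :: real" "- 1 / 2" n]
    by (simp add: atMost_atLeast0 flip: sum_distrib_left)
  also have "\<dots> = 1"
  proof -
    have "(- 1 :: real) gchoose n = (- 1) ^ n * (real n gchoose n)"
      using gbinomial_minus[of "1::real" n] by simp
    also have "real n gchoose n = 1"
      using binomial_gbinomial[of n n, where 'a = real] by simp
    finally show ?thesis by (simp flip: power_mult_distrib)
  qed
  finally show ?thesis .
qed

lemma inv_sqrt_coeff_sq_le: "(inv_sqrt_coeff n)\<^sup>2 \<le> 1 / (2 * real n + 1)"
proof (induction n)
  case 0
  show ?case by (simp add: inv_sqrt_coeff_def)
next
  case (Suc n)
  have step: "inv_sqrt_coeff (Suc n) = inv_sqrt_coeff n * ((2 * real n + 1) / (2 * real n + 2))"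
  proof -
    have "2 * real (n + 1) * ((- 1 / 2) gchoose Suc n) = - (2 * real n + 1) * ((- 1 / 2 :: real) gchoose n)"
      using gbinomial_mult_1[of "- 1 / 2 :: real" n] by (simp add: algebra_simps)
    then have "(- 1 / 2 :: real) gchoose Suc n = - ((2 * real n + 1) / (2 * real n + 2)) * ((- 1 / 2) gchoose n)"
      by (simp add: field_simps)
    then show ?thesis by (simp only: inv_sqrt_coeff_def power_Suc) simp
  qed
  have "(inv_sqrt_coeff (Suc n))\<^sup>2 \<le> 1 / (2 * real n + 1) * ((2 * real n + 1) / (2 * real n + 2))\<^sup>2"
    unfolding step power_mult_distrib by (intro mult_right_mono Suc.IH) simp
  also have "\<dots> \<le> 1 / (2 * real (Suc n) + 1)"
  proof -
    have "1 / u * (u / (u + 1))\<^sup>2 \<le> 1 / (u + 2)" if "u > 0" for u :: real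
    proof -
      have "1 / u * (u / (u + 1))\<^sup>2 = u / (u + 1)\<^sup>2"
        using that by (simp add: power2_eq_square)
      also have "\<dots> \<le> 1 / (u + 2)"
      proof -
        have "u * (u + 2) \<le> 1 * (u + 1)\<^sup>2" by (simp add: power2_eq_square algebra_simps)
        then show ?thesis using that by (simp add: frac_le_eq pos_divide_le_eq pos_le_divide_eq)
      qed
      finally show ?thesis .
    qed
    from this[of "2 * real n + 1"] show ?thesis by (simp add: add.commute add.left_commute)
  qed
  finally show ?case .
qed

text \<open>What matters is that the bound is of smaller order than \<open>1 / sqrt (1 - x)\<close> as \<open>x\<close> tends to 1; this
  makes the contribution of \<open>c / (1 - z)\<close> to the mean value inequality negligible.\<close>

lemma inv_sqrt_coeff_sum_le:
  fixes x :: real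
  assumes x: "0 < x" "x < 1"
  shows "(\<Sum>n. (inv_sqrt_coeff n)\<^sup>2 * x ^ n) \<le> - ln (1 - x) / x"
proof -
  have sg: "summable (\<lambda>n. x ^ n)" using x by (simp add: summable_geometric)
  have s1: "summable (\<lambda>n. (inv_sqrt_coeff n)\<^sup>2 * x ^ n)"
  proof (rule summable_comparison_test[OF _ sg], intro exI allI impI)
    fix n
    have "(inv_sqrt_coeff n)\<^sup>2 \<le> 1" using inv_sqrt_coeff_sq_le[of n] by (rule order_trans) simp
    then show "norm ((inv_sqrt_coeff n)\<^sup>2 * x ^ n) \<le> x ^ n" using x by (simp add: mult_left_le_one_le)
  qed
  have s2: "summable (\<lambda>n. x ^ n / (real n + 1))"
    using x by (intro summable_comparison_test[OF _ sg]) (auto simp: field_simps)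
  have "- ln (1 - x) = (\<Sum>n. x * (x ^ n / (real n + 1)))"
  proof -
    have "ln (1 - x) = (\<Sum>n. (- 1) ^ n * (1 / real (n + 1)) * (1 - x - 1) ^ Suc n)"
      using x by (intro ln_series) auto
    also have "(\<lambda>n. (- 1) ^ n * (1 / real (n + 1)) * (1 - x - 1) ^ Suc n) = (\<lambda>n. - (x * (x ^ n / (real n + 1))))"
    proof (rule ext)
      fix n
      have "(- 1) ^ n * (1 / real (n + 1)) * (1 - x - 1) ^ Suc n = ((- 1) * (- x)) ^ n * (- x) / (real n + 1)"
        by (simp only: power_mult_distrib) (simp add: mult_ac add.commute)
      then show "(- 1) ^ n * (1 / real (n + 1)) * (1 - x - 1) ^ Suc n = - (x * (x ^ n / (real n + 1)))"
        by simp
    qed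
    finally show ?thesis using suminf_minus[OF summable_mult[OF s2, of x]] by simp
  qed
  also have "\<dots> = x * (\<Sum>n. x ^ n / (real n + 1))" by (rule suminf_mult[OF s2])
  finally have "- ln (1 - x) / x = (\<Sum>n. x ^ n / (real n + 1))" using x by simp
  moreover have "(\<Sum>n. (inv_sqrt_coeff n)\<^sup>2 * x ^ n) \<le> (\<Sum>n. x ^ n / (real n + 1))"
  proof (rule suminf_le[OF _ s1 s2])
    fix n
    have "(inv_sqrt_coeff n)\<^sup>2 \<le> 1 / (real n + 1)"
      using inv_sqrt_coeff_sq_le[of n] by (rule order_trans) (simp add: field_simps)
    then show "(inv_sqrt_coeff n)\<^sup>2 * x ^ n \<le> x ^ n / (real n + 1)"
      using x mult_right_mono[of "(inv_sqrt_coeff n)\<^sup>2" "1 / (real n + 1)" "x ^ n"] by simp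
  qed
  ultimately show ?thesis by simp
qed

section \<open>Abel means\<close>

lemma summable_abs_bounded_coeff:
  fixes u :: "nat \<Rightarrow> real"
  assumes "0 \<le> x" "x < 1" and "\<And>n. \<bar>u n\<bar> \<le> C"
  shows "summable (\<lambda>n. \<bar>u n * x ^ n\<bar>)"
proof (rule summable_comparison_test)
  show "\<exists>N. \<forall>n\<ge>N. norm \<bar>u n * x ^ n\<bar> \<le> C * x ^ n"
    using assms by (auto simp: abs_mult intro!: mult_right_mono)
  show "summable (\<lambda>n. C * x ^ n)"
    using assms by (intro summable_mult summable_geometric) auto
qed

text \<open>Summation by parts in generating function form: dividing \<open>\<Sum>n. w n x\<^sup>n\<close> by \<open>1 - x\<close> produces the
  partial sums of \<open>w\<close> as coefficients, and these are compared with \<open>\<Sum>n. (n + 1) x\<^sup>n = 1 / (1 - x)\<^sup>2\<close>.\<close>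

lemma abel_mean_le:
  fixes w :: "nat \<Rightarrow> real"
  assumes x: "0 < x" "x < 1" and w: "\<And>n. \<bar>w n\<bar> \<le> C"
    and W: "\<And>n. (\<Sum>k\<le>n. w k) \<le> \<beta> * real n + K" and \<beta>: "\<beta> \<ge> 0"
  shows "(1 - x) * (\<Sum>n. w n * x ^ n) \<le> \<beta> + K * (1 - x)"
proof -
  have sg: "summable (\<lambda>n. x ^ n)" using x by (simp add: summable_geometric)
  have sw: "summable (\<lambda>n. norm (w n * x ^ n))"
    using summable_abs_bounded_coeff[OF _ x(2) w] x(1) by simp
  have "(\<lambda>n. \<Sum>i\<le>n. (w i * x ^ i) * x ^ (n - i)) sums ((\<Sum>n. w n * x ^ n) * (\<Sum>n. x ^ n))"
    using sw sg x by (intro Cauchy_product_sums) simp_all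
  also have "(\<lambda>n. \<Sum>i\<le>n. (w i * x ^ i) * x ^ (n - i)) = (\<lambda>n. (\<Sum>k\<le>n. w k) * x ^ n)"
    by (rule ext) (simp add: sum_distrib_right mult.assoc flip: power_add)
  finally have 1: "(\<lambda>n. (\<Sum>k\<le>n. w k) * x ^ n) sums ((\<Sum>n. w n * x ^ n) * (1 / (1 - x)))"
    using x by (simp add: suminf_geometric)
  have 2: "(\<lambda>n. \<beta> * (of_nat (Suc n) * x ^ n) + K * x ^ n) sums (\<beta> * (1 / (1 - x)^2) + K * (1 / (1 - x)))"
    using x by (intro sums_add sums_mult geometric_deriv_sums geometric_sums) auto
  have "(\<Sum>n. w n * x ^ n) * (1 / (1 - x)) \<le> \<beta> * (1 / (1 - x)^2) + K * (1 / (1 - x))"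
  proof (rule sums_le[OF _ 1 2])
    fix n
    have "(\<Sum>k\<le>n. w k) * x ^ n \<le> (\<beta> * real (Suc n) + K) * x ^ n"
      using W[of n] x \<beta> by (intro mult_right_mono) (auto simp: algebra_simps)
    then show "(\<Sum>k\<le>n. w k) * x ^ n \<le> \<beta> * (of_nat (Suc n) * x ^ n) + K * x ^ n"
      by (simp add: algebra_simps)
  qed
  from mult_right_mono[OF this, of "(1 - x)^2"]
  have "(\<Sum>n. w n * x ^ n) * ((1 - x)\<^sup>2 / (1 - x)) \<le> \<beta> * ((1 - x)\<^sup>2 / (1 - x)\<^sup>2) + K * ((1 - x)\<^sup>2 / (1 - x))"
    by (simp only: distrib_right times_divide_eq_right times_divide_eq_left mult_1_left
        mult_1_right mult.assoc zero_le_power2 simp_thms)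
  moreover have "(1 - x)\<^sup>2 / (1 - x) = 1 - x" "(1 - x)\<^sup>2 / (1 - x)\<^sup>2 = 1"
    using x by (simp_all add: power2_eq_square)
  ultimately show ?thesis by (simp only: mult.commute mult_1_left mult_1_right)
qed

section \<open>The representation function\<close>

lemma rep_count_eq_sum:
  "real (rep_count A n) = (\<Sum>i\<le>n. indicator A i * indicator A (n - i))"
proof -
  have "bij_betw fst {(a, b). a \<in> A \<and> b \<in> A \<and> a + b = n} {i\<in>{..n}. i \<in> A \<and> n - i \<in> A}"
    by (rule bij_betw_byWitness[of _ "\<lambda>i. (i, n - i)"]) auto
  then have "rep_count A n = card {i\<in>{..n}. i \<in> A \<and> n - i \<in> A}"
    unfolding rep_count_def by (rule bij_betw_same_card)
  also have "real \<dots> = (\<Sum>i\<le>n. indicator {i. i \<in> A \<and> n - i \<in> A} i)"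
    by (simp add: indicator_def sum.If_cases Int_def)
  also have "\<dots> = (\<Sum>i\<le>n. indicator A i * indicator A (n - i))"
    by (rule sum.cong) (auto simp: indicator_def)
  finally show ?thesis .
qed

text \<open>Swapping the summands pairs off all representations except \<open>a + a\<close>.\<close>

lemma odd_rep_count:
  assumes "odd (rep_count A n)"
  shows "\<exists>a\<in>A. n = 2 * a"
proof (rule ccontr)
  assume no: "\<not> ?thesis"
  define P where "P = {(a, b). a \<in> A \<and> b \<in> A \<and> a + b = n}"
  define L where "L = {p\<in>P. fst p < snd p}"
  define U where "U = {p\<in>P. snd p < fst p}"
  have fin: "finite P" unfolding P_def by (rule finite_rep_pairs)
  have "P = L \<union> U" using no by (force simp: P_def L_def U_def)
  then have "card P = card L + card U"
    using fin by (subst card_Un_disjoint[symmetric]) (auto simp: L_def U_def)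
  moreover have "card L = card U"
    by (rule bij_betw_same_card[of prod.swap], rule bij_betw_byWitness[of _ prod.swap])
      (auto simp: L_def U_def P_def)
  ultimately show False using assms by (simp add: rep_count_def P_def)
qed

text \<open>Every pair of elements of \<open>A\<close> up to \<open>n\<close> is a representation of some number up to \<open>2n\<close>.\<close>

lemma counting_sq_le:
  assumes "\<And>n. rep_count A n \<le> B"
  shows "(card (A \<inter> {..n}))\<^sup>2 \<le> B * (2 * n + 1)"
proof -
  have "(A \<inter> {..n}) \<times> (A \<inter> {..n}) \<subseteq> (\<Union>m\<le>2 * n. {(a, b). a \<in> A \<and> b \<in> A \<and> a + b = m})"
    by auto
  then have "card ((A \<inter> {..n}) \<times> (A \<inter> {..n})) \<le> card (\<Union>m\<le>2 * n. {(a, b). a \<in> A \<and> b \<in> A \<and> a + b = m})"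
    by (intro card_mono finite_UN_I finite_rep_pairs) auto
  also have "\<dots> \<le> (\<Sum>m\<le>2 * n. rep_count A m)"
    unfolding rep_count_def by (rule card_UN_le) simp
  also have "\<dots> \<le> (\<Sum>m\<le>2 * n. B)" by (intro sum_mono assms)
  finally show ?thesis by (simp add: card_cartesian_product power2_eq_square mult.commute)
qed

section \<open>The mean square deviation of the representation function\<close>

text \<open>The mean value inequality on the circle of radius \<open>sqrt x\<close>, for \<open>f\<^sup>2 = c h\<^sup>2 + D\<close>. Its left side
  is \<open>\<Sum>a\<in>A. x\<^sup>a = f(x)\<close>, because squaring the coefficients 0 and 1 changes nothing, and \<open>f(x)\<close> is
  the square root of the generating function of \<open>r\<close>.\<close>

lemma sqrt_gen_fun_rep_count_le:
  fixes c x :: real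
  assumes B: "\<And>n. rep_count A n \<le> B" and x: "0 < x" "x < 1" and c: "c \<ge> 0"
  shows "sqrt (\<Sum>n. real (rep_count A n) * x ^ n)
    \<le> c * (- ln (1 - x) / x) + sqrt (\<Sum>n. (real (rep_count A n) - c)\<^sup>2 * x ^ n)"
proof -
  define \<rho> where "\<rho> = sqrt x"
  have \<rho>: "0 \<le> \<rho>" "\<rho> < 1" using x by (auto simp: \<rho>_def)
  have sq: "(u * \<rho> ^ n)\<^sup>2 = u\<^sup>2 * x ^ n" for u n
  proof -
    have "(\<rho> ^ n)\<^sup>2 = (\<rho>\<^sup>2) ^ n" by (simp only: mult.commute flip: power_mult)
    then show ?thesis using x by (simp add: \<rho>_def power_mult_distrib)
  qed
  have conv: "(\<Sum>i\<le>n. (u i * z ^ i) * (u (n - i) * z ^ (n - i))) = (\<Sum>i\<le>n. u i * u (n - i)) * z ^ n"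
    for u :: "nat \<Rightarrow> real" and z n
    unfolding sum_distrib_right
  proof (rule sum.cong)
    fix i assume "i \<in> {..n}"
    then have "z ^ n = z ^ i * z ^ (n - i)" by (simp flip: power_add)
    then show "(u i * z ^ i) * (u (n - i) * z ^ (n - i)) = u i * u (n - i) * z ^ n" by simp
  qed simp
  have ind: "\<bar>indicator A n :: real\<bar> \<le> 1" for n by (simp add: indicator_def)
  have hle: "\<bar>inv_sqrt_coeff n\<bar> \<le> 1" for n
  proof -
    have "(inv_sqrt_coeff n)\<^sup>2 \<le> 1" using inv_sqrt_coeff_sq_le[of n] by (rule order_trans) simp
    then show ?thesis by (simp add: abs_square_le_1)
  qed
  have dle: "\<bar>real (rep_count A n) - c\<bar> \<le> real B + c" for n using B[of n] c by linarith
  have bound: "(\<Sum>n. (indicator A n * \<rho> ^ n)\<^sup>2) \<le> c * (\<Sum>n. (inv_sqrt_coeff n * \<rho> ^ n)\<^sup>2)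
      + sqrt (\<Sum>n. ((real (rep_count A n) - c) * \<rho> ^ n)\<^sup>2)"
  proof (rule sum_squares_le_of_self_convolution[OF _ _ _ c])
    show "summable (\<lambda>n. \<bar>indicator A n * \<rho> ^ n\<bar>)"
      by (rule summable_abs_bounded_coeff[OF \<rho> ind])
    show "summable (\<lambda>n. \<bar>inv_sqrt_coeff n * \<rho> ^ n\<bar>)"
      by (rule summable_abs_bounded_coeff[OF \<rho> hle])
    show "summable (\<lambda>n. \<bar>(real (rep_count A n) - c) * \<rho> ^ n\<bar>)"
      by (rule summable_abs_bounded_coeff[OF \<rho> dle])
    show "(\<Sum>i\<le>n. (indicator A i * \<rho> ^ i) * (indicator A (n - i) * \<rho> ^ (n - i)))
      = c * (\<Sum>i\<le>n. (inv_sqrt_coeff i * \<rho> ^ i) * (inv_sqrt_coeff (n - i) * \<rho> ^ (n - i)))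
        + (real (rep_count A n) - c) * \<rho> ^ n" for n
      unfolding conv inv_sqrt_coeff_conv rep_count_eq_sum by (simp add: left_diff_distrib)
  qed
  have main: "(\<Sum>n. indicator A n * x ^ n) \<le> c * (\<Sum>n. (inv_sqrt_coeff n)\<^sup>2 * x ^ n)
      + sqrt (\<Sum>n. (real (rep_count A n) - c)\<^sup>2 * x ^ n)"
  proof -
    have "(indicator A n :: real)\<^sup>2 = indicator A n" for n by (simp add: indicator_def)
    then show ?thesis using bound unfolding sq by simp
  qed
  have sA: "summable (\<lambda>n. \<bar>indicator A n * x ^ n\<bar>)"
    using x by (intro summable_abs_bounded_coeff[OF _ _ ind]) auto
  have "(\<Sum>n. indicator A n * x ^ n) * (\<Sum>n. indicator A n * x ^ n)
      = (\<Sum>n. \<Sum>i\<le>n. (indicator A i * x ^ i) * (indicator A (n - i) * x ^ (n - i)))"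
    using sA by (intro Cauchy_product) (simp_all only: real_norm_def)
  then have "(\<Sum>n. indicator A n * x ^ n)\<^sup>2 = (\<Sum>n. real (rep_count A n) * x ^ n)"
    unfolding conv rep_count_eq_sum power2_eq_square .
  moreover have "(\<Sum>n. indicator A n * x ^ n) \<ge> 0"
    using x summable_rabs_cancel[OF sA] by (intro suminf_nonneg) auto
  ultimately have "sqrt (\<Sum>n. real (rep_count A n) * x ^ n) = (\<Sum>n. indicator A n * x ^ n)"
    by (metis real_sqrt_unique)
  then show ?thesis
    using main mult_left_mono[OF inv_sqrt_coeff_sum_le[OF x] c] by linarith
qed

text \<open>Write \<open>R\<close> and \<open>V\<close> for the Abel means of \<open>r(n)\<close> and \<open>(r(n) - c)\<^sup>2\<close>. The preceding inequality, times
  \<open>sqrt (1 - x)\<close>, reads \<open>sqrt R \<le> \<epsilon> + sqrt V\<close> where \<open>\<epsilon>\<close> tends to 0 as \<open>x\<close> tends to 1. As \<open>R\<close> is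
  bounded, squaring it costs only an error that tends to 0.\<close>

lemma mean_square_deviation_lower_bound:
  fixes c \<delta> :: real
  assumes B: "\<And>n. rep_count A n \<le> B" and c: "c \<ge> 0" and \<delta>: "\<delta> > 0"
  shows "eventually (\<lambda>x. - \<delta> <
    (1 - x) * (\<Sum>n. ((real (rep_count A n) - c)\<^sup>2 - real (rep_count A n)) * x ^ n)) (at_left 1)"
proof -
  define \<epsilon> where "\<epsilon> x = c * (sqrt (1 - x) * (- ln (1 - x) / x))" for x :: real
  have "((\<lambda>x::real. sqrt (1 - x) * (- ln (1 - x) / x)) \<longlongrightarrow> 0) (at_left 1)"
    by real_asymp
  then have "(\<epsilon> \<longlongrightarrow> c * 0) (at_left 1)" unfolding \<epsilon>_def by (intro tendsto_mult_left)
  then have "((\<lambda>x. (\<epsilon> x)\<^sup>2 + 2 * \<epsilon> x * sqrt B) \<longlongrightarrow> (c * 0)\<^sup>2 + 2 * (c * 0) * sqrt B) (at_left 1)"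
    by (intro tendsto_intros)
  then have small: "eventually (\<lambda>x. (\<epsilon> x)\<^sup>2 + 2 * \<epsilon> x * sqrt B < \<delta>) (at_left 1)"
    using \<delta> by (intro order_tendstoD(2)) auto
  have near: "eventually (\<lambda>x. x \<in> {0<..<1}) (at_left (1::real))"
    by (rule eventually_at_leftI[of 0]) auto
  show ?thesis using small near
  proof eventually_elim
    case (elim x)
    then have x: "0 < x" "x < 1" by auto
    define r where "r n = real (rep_count A n)" for n
    define R where "R = (1 - x) * (\<Sum>n. r n * x ^ n)"
    define V where "V = (1 - x) * (\<Sum>n. (r n - c)\<^sup>2 * x ^ n)"
    have rB: "\<bar>r n\<bar> \<le> real B" for n using B by (simp add: r_def)
    have vB: "\<bar>(r n - c)\<^sup>2\<bar> \<le> (real B + c)\<^sup>2" for n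
      using rB[of n] c by (auto intro!: power2_le_iff_abs_le[THEN iffD2])
    have sr: "summable (\<lambda>n. r n * x ^ n)"
      using x by (intro summable_rabs_cancel[OF summable_abs_bounded_coeff[OF _ _ rB]]) auto
    have sv: "summable (\<lambda>n. (r n - c)\<^sup>2 * x ^ n)"
      using x by (intro summable_rabs_cancel[OF summable_abs_bounded_coeff[OF _ _ vB]]) auto
    have split: "(1 - x) * (\<Sum>n. ((r n - c)\<^sup>2 - r n) * x ^ n) = V - R"
      unfolding V_def R_def left_diff_distrib[of _ _ "x ^ _"] suminf_diff[OF sv sr, symmetric]
      by (simp add: algebra_simps)
    have V0: "V \<ge> 0" unfolding V_def using x sv by (intro mult_nonneg_nonneg suminf_nonneg) auto
    have R0: "R \<ge> 0" unfolding R_def r_def using x sr[unfolded r_def]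
      by (intro mult_nonneg_nonneg suminf_nonneg) auto
    have "(\<Sum>n. r n * x ^ n) \<le> (\<Sum>n. real B * x ^ n)"
      using rB x by (intro suminf_le sr summable_mult summable_geometric mult_right_mono)
        (auto simp: abs_le_iff)
    also have "\<dots> = real B / (1 - x)"
      using x by (simp add: suminf_mult summable_geometric suminf_geometric)
    finally have RB: "R \<le> real B" unfolding R_def using x by (simp add: field_simps)
    have "sqrt (\<Sum>n. r n * x ^ n) \<le> c * (- ln (1 - x) / x) + sqrt (\<Sum>n. (r n - c)\<^sup>2 * x ^ n)"
      unfolding r_def by (rule sqrt_gen_fun_rep_count_le[OF B x c])
    then have "sqrt (1 - x) * sqrt (\<Sum>n. r n * x ^ n)
        \<le> sqrt (1 - x) * (c * (- ln (1 - x) / x) + sqrt (\<Sum>n. (r n - c)\<^sup>2 * x ^ n))"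
      using x by (intro mult_left_mono) auto
    then have "sqrt R \<le> \<epsilon> x + sqrt V"
      unfolding R_def V_def \<epsilon>_def real_sqrt_mult distrib_left[of "sqrt (1 - x)"]
        mult.left_commute[of _ c] .
    then have "(sqrt R)\<^sup>2 \<le> (\<epsilon> x + sqrt V)\<^sup>2" using R0 by (intro power_mono) auto
    then have le: "R \<le> (\<epsilon> x)\<^sup>2 + 2 * \<epsilon> x * sqrt V + V"
      using R0 V0 by (simp add: power2_sum)
    have \<epsilon>0: "\<epsilon> x \<ge> 0" unfolding \<epsilon>_def using x c
      by (intro mult_nonneg_nonneg divide_nonneg_pos) auto
    have "- \<delta> < V - R"
    proof (cases "V \<le> R")
      case True
      then have "2 * \<epsilon> x * sqrt V \<le> 2 * \<epsilon> x * sqrt B"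
        using \<epsilon>0 RB by (intro mult_left_mono) auto
      then show ?thesis using le elim(1) by linarith
    next
      case False
      then show ?thesis using \<delta> by linarith
    qed
    then show ?case unfolding split[symmetric] r_def .
  qed
qed

section \<open>Densities and the theorem\<close>

text \<open>The square of the counting function grows at most linearly. The inequality
  \<open>y \<le> s y\<^sup>2 + 1 / (4 s)\<close> converts this into a linear bound with an arbitrarily small slope.\<close>

lemma counting_function_sublinear:
  assumes B: "\<And>n. rep_count A n \<le> B" and e: "\<epsilon> > 0"
  obtains K where "\<And>n. real (card (A \<inter> {..n})) \<le> \<epsilon> * real n + K"
proof -
  define s where "s = \<epsilon> / (2 * real B + 1)"
  have s: "s > 0" unfolding s_def using e by simp
  have sB: "s * (2 * real B) \<le> \<epsilon>"
  proof -
    have "s * (2 * real B) \<le> s * (2 * real B + 1)" using s by (intro mult_left_mono) auto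
    also have "\<dots> = \<epsilon>" by (simp add: s_def add_nonneg_eq_0_iff)
    finally show ?thesis .
  qed
  have "real (card (A \<inter> {..n})) \<le> \<epsilon> * real n + (s * real B + 1 / (4 * s))" for n
  proof -
    define y where "y = real (card (A \<inter> {..n}))"
    have "y\<^sup>2 \<le> real B * (2 * real n + 1)"
    proof -
      have "real ((card (A \<inter> {..n}))\<^sup>2) \<le> real (B * (2 * n + 1))"
        using counting_sq_le[OF B, of n] by (rule of_nat_mono)
      then show ?thesis by (simp add: y_def distrib_left)
    qed
    then have "s * y\<^sup>2 \<le> s * (real B * (2 * real n + 1))" using s by (intro mult_left_mono) auto
    also have "\<dots> = (s * (2 * real B)) * real n + s * real B" by (simp add: algebra_simps)
    also have "\<dots> \<le> \<epsilon> * real n + s * real B" using sB by (intro add_right_mono mult_right_mono) auto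
    finally have 1: "s * y\<^sup>2 \<le> \<epsilon> * real n + s * real B" .
    have "0 \<le> (2 * s * y - 1)\<^sup>2 / (4 * s)" using s by simp
    also have "\<dots> = s * y\<^sup>2 - y + 1 / (4 * s)"
    proof -
      have "(2 * s * y - 1)\<^sup>2 = 4 * s * (s * y\<^sup>2) - 4 * s * y + 1"
        by (simp add: power2_eq_square algebra_simps)
      then show ?thesis using s by (simp add: add_divide_distrib diff_divide_distrib)
    qed
    finally show ?thesis using 1 unfolding y_def by linarith
  qed
  then show ?thesis by (rule that)
qed

lemma upper_density_lessE:
  assumes "upper_density E < ereal \<beta>"
  obtains b K where "b < \<beta>" "b \<ge> 0" "\<And>n. real (card (E \<inter> {1..n})) \<le> b * real n + K"
proof -
  obtain z where z: "upper_density E < z" "z < ereal \<beta>" using assms dense by blast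
  have ev: "eventually (\<lambda>n. ereal (real (card (E \<inter> {1..n})) / real n) < z) sequentially"
    using z(1) unfolding upper_density_def by (rule Limsup_lessD)
  obtain n where n: "ereal (real (card (E \<inter> {1..n})) / real n) < z"
    using eventually_happens[OF ev] by auto
  have "0 \<le> real (card (E \<inter> {1..n})) / real n" by simp
  then have "ereal 0 < z" using n by (metis ereal_less_eq(3) order.strict_trans1)
  with z(2) obtain b where b: "z = ereal b" "b < \<beta>" "b \<ge> 0" by (cases z) auto
  obtain N where N: "\<And>n. n \<ge> N \<Longrightarrow> real (card (E \<inter> {1..n})) / real n < b"
    using ev unfolding b eventually_sequentially by auto
  have "real (card (E \<inter> {1..n})) \<le> b * real n + real N" for n
  proof (cases "n \<ge> N")
    case True
    show ?thesis
    proof (cases "n = 0")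
      case False
      with N[OF True] have "real (card (E \<inter> {1..n})) < b * real n" by (simp add: field_simps)
      then show ?thesis by simp
    qed simp
  next
    case False
    have "card (E \<inter> {1..n}) \<le> card {1..n}" by (intro card_mono) auto
    then have "real (card (E \<inter> {1..n})) \<le> real N" using False by simp
    then show ?thesis using b(3) by (simp add: add_increasing)
  qed
  then show ?thesis by (rule that[OF b(2,3)])
qed

theorem theorem1:
  fixes A E :: "nat set"
  assumes "A \<subseteq> {1..}"
    and "E = {1..} - (A + A)"
    and "upper_density E < ereal (7 / 32)"
  shows "limsup (\<lambda>n. ereal (real (rep_count A n))) > 5"
proof (rule ccontr)
  assume "\<not> ?thesis"
  then have "limsup (\<lambda>n. ereal (real (rep_count A n))) \<le> 5" by (simp add: not_less)
  also have "(5 :: ereal) < ereal 6" by simp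
  finally have "eventually (\<lambda>n. ereal (real (rep_count A n)) < ereal 6) sequentially"
    by (rule Limsup_lessD)
  then obtain N where "\<And>n. n \<ge> N \<Longrightarrow> rep_count A n < 6"
    unfolding eventually_sequentially by auto
  then have N: "rep_count A n \<le> 5" if "n \<ge> N" for n using that by force
  define B where "B = Max (insert 5 (rep_count A ` {..N}))"
  have B: "rep_count A n \<le> B" for n
  proof (cases "n \<le> N")
    case True then show ?thesis unfolding B_def by (intro Max_ge) auto
  next
    case False
    then have "rep_count A n \<le> 5" using N by simp
    also have "5 \<le> B" unfolding B_def by (intro Max_ge) auto
    finally show ?thesis .
  qed
  obtain b K where b: "b < 7 / 32" "b \<ge> 0" and
    K: "\<And>n. real (card (E \<inter> {1..n})) \<le> b * real n + K"
    by (rule upper_density_lessE[OF assms(3)]) (rule that)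
  \<comment> \<open>The averages of \<open>(r(n) - 5/2)\<^sup>2 - r(n)\<close> are asymptotically at most \<open>-\<delta>\<close>.\<close>
  define \<delta> where "\<delta> = 7 / 4 - 8 * b"
  have \<delta>: "\<delta> > 0" using b by (simp add: \<delta>_def)
  \<comment> \<open>\<open>Q\<close> is the sparse set of exceptions, where \<open>r(n)\<close> may be odd or exceed 5; there the crude
    bound by \<open>C\<close> suffices.\<close>
  define Q where "Q = {..N} \<union> (\<lambda>a. 2 * a) ` A"
  define C where "C = (real B)\<^sup>2 + 8"
  have C: "C > 0" by (simp add: C_def add_nonneg_pos)
  \<comment> \<open>The coefficient \<open>8 = 25/4 + 7/4\<close> is the gap between the value of \<open>g\<close> at \<open>r(n) = 0\<close> and its
    common value at \<open>r(n) = 2\<close> and \<open>r(n) = 4\<close>; the latter two agree because of the choice of \<open>5/2\<close>.\<close>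
  define w where "w n = 8 * indicator E n + C * indicator Q n" for n :: nat
  define g where "g n = (real (rep_count A n) - 5 / 2)\<^sup>2 - real (rep_count A n)" for n
  have gle: "g n \<le> w n - 7 / 4" for n
  proof (cases "n \<in> Q")
    case True
    have "(real (rep_count A n))\<^sup>2 \<le> (real B)\<^sup>2" using B by (intro power_mono) auto
    moreover have "g n = (real (rep_count A n))\<^sup>2 - 6 * real (rep_count A n) + 25 / 4"
      by (simp add: g_def power2_diff power_divide)
    ultimately have "g n \<le> C - 7 / 4" unfolding C_def by linarith
    also have "C \<le> w n" using True by (simp add: w_def indicator_def)
    finally show ?thesis by simp
  next
    case False
    then have n: "n > N" "\<not> (\<exists>a\<in>A. n = 2 * a)" by (auto simp: Q_def)
    have "rep_count A n \<le> 5" "even (rep_count A n)" using N[of n] n odd_rep_count by auto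
    then obtain k where k: "rep_count A n = 2 * k" "k \<le> 2" by (elim evenE) simp
    then have "k = 0 \<or> k = 1 \<or> k = 2" by linarith
    with k have "rep_count A n \<in> {0, 2, 4}" by auto
    moreover have "n \<in> E" if "rep_count A n = 0"
    proof -
      have "{(a, b). a \<in> A \<and> b \<in> A \<and> a + b = n} = {}"
        using that unfolding rep_count_def by (simp add: finite_rep_pairs)
      then show ?thesis using n(1) by (auto simp: assms(2) set_plus_def)
    qed
    ultimately show ?thesis using C by (auto simp: g_def w_def indicator_def power2_eq_square)
  qed
  \<comment> \<open>With this slope the exceptions, which have weight \<open>C\<close>, use up only half of \<open>\<delta>\<close>.\<close>
  have eps: "\<delta> / (2 * C) > 0" using \<delta> C by simp
  obtain K' where K': "\<And>n. real (card (A \<inter> {..n})) \<le> \<delta> / (2 * C) * real n + K'"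
    by (rule counting_function_sublinear[OF B eps]) (rule that)
  define L where "L = 8 * K + C * (real N + 1 + K')"
  have W: "(\<Sum>k\<le>n. w k) \<le> (7 / 4 - \<delta> / 2) * real n + L" for n
  proof -
    have cardQ: "real (card (Q \<inter> {..n})) \<le> real N + 1 + (\<delta> / (2 * C) * real n + K')"
    proof -
      have "card (Q \<inter> {..n}) \<le> card ({..N} \<union> (\<lambda>a. 2 * a) ` (A \<inter> {..n}))"
        by (intro card_mono) (auto simp: Q_def)
      also have "\<dots> \<le> card {..N} + card ((\<lambda>a. 2 * a) ` (A \<inter> {..n}))" by (rule card_Un_le)
      also have "\<dots> \<le> (N + 1) + card (A \<inter> {..n})" using card_image_le[of "A \<inter> {..n}"] by simp
      finally show ?thesis using K'[of n] by linarith
    qed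
    have "E \<inter> {..n} = E \<inter> {1..n}" using assms(2) by auto
    then have cardE: "real (card (E \<inter> {..n})) \<le> b * real n + K" using K[of n] by simp
    have "(\<Sum>k\<le>n. w k) = 8 * real (card (E \<inter> {..n})) + C * real (card (Q \<inter> {..n}))"
    proof -
      have "(\<Sum>k\<le>n. indicator X k) = real (card (X \<inter> {..n}))" for X :: "nat set"
        by (simp add: indicator_def sum.If_cases Int_commute)
      then show ?thesis by (simp add: w_def sum.distrib flip: sum_distrib_left)
    qed
    also have "\<dots> \<le> 8 * (b * real n + K) + C * (real N + 1 + (\<delta> / (2 * C) * real n + K'))"
      using cardE cardQ C by (intro add_mono mult_left_mono) auto
    also have "\<dots> = (7 / 4 - \<delta> / 2) * real n + L"
    proof -
      have 1: "C * (\<delta> / (2 * C) * real n) = \<delta> / 2 * real n" using C by simp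
      have 2: "C * (real N + 1 + (y + K')) = C * (real N + 1 + K') + C * y" for y
        by (simp add: algebra_simps)
      have 3: "8 * (b * real n + K) = (7 / 4 - \<delta>) * real n + 8 * K"
        by (simp add: \<delta>_def algebra_simps)
      show ?thesis unfolding 1 2 3 L_def by (simp add: algebra_simps)
    qed
    finally show ?thesis .
  qed
  have wC: "\<bar>w n\<bar> \<le> 8 + C" for n using C by (simp add: w_def indicator_def)
  have upper: "(1 - x) * (\<Sum>n. g n * x ^ n) \<le> - \<delta> / 2 + L * (1 - x)" if x: "0 < x" "x < 1" for x
  proof -
    have gB: "\<bar>g n\<bar> \<le> (real B + 5 / 2)\<^sup>2 + real B" for n
    proof -
      have r: "0 \<le> real (rep_count A n)" "real (rep_count A n) \<le> real B" using B by simp_all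
      then have "\<bar>real (rep_count A n) - 5 / 2\<bar> \<le> real B + 5 / 2" by linarith
      then have "(real (rep_count A n) - 5 / 2)\<^sup>2 \<le> (real B + 5 / 2)\<^sup>2"
        by (metis abs_ge_zero power2_abs power_mono)
      moreover have "0 \<le> (real (rep_count A n) - 5 / 2)\<^sup>2" by simp
      ultimately show ?thesis unfolding g_def using r by linarith
    qed
    have sg: "summable (\<lambda>n. g n * x ^ n)"
      using x by (intro summable_rabs_cancel[OF summable_abs_bounded_coeff[OF _ _ gB]]) auto
    have sw: "summable (\<lambda>n. w n * x ^ n)"
      using x by (intro summable_rabs_cancel[OF summable_abs_bounded_coeff[OF _ _ wC]]) auto
    have geo: "(\<lambda>n. 7 / 4 * x ^ n) sums (7 / 4 * (1 / (1 - x)))"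
      using x by (intro sums_mult geometric_sums) auto
    have "(\<Sum>n. g n * x ^ n) \<le> (\<Sum>n. w n * x ^ n - 7 / 4 * x ^ n)"
    proof (rule suminf_le[OF _ sg])
      show "g n * x ^ n \<le> w n * x ^ n - 7 / 4 * x ^ n" for n
        using mult_right_mono[OF gle, of "x ^ n" n] x by (simp add: left_diff_distrib)
    qed (intro summable_diff sw sums_summable[OF geo])
    also have "\<dots> = (\<Sum>n. w n * x ^ n) - 7 / 4 * (1 / (1 - x))"
      using suminf_diff[OF sw sums_summable[OF geo]] sums_unique[OF geo] by simp
    finally have "(1 - x) * (\<Sum>n. g n * x ^ n) \<le> (1 - x) * ((\<Sum>n. w n * x ^ n) - 7 / 4 * (1 / (1 - x)))"
      using x by (intro mult_left_mono) auto
    also have "\<dots> = (1 - x) * (\<Sum>n. w n * x ^ n) - 7 / 4"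
    proof -
      have "(1 - x) * (1 / (1 - x)) = 1" using x by simp
      then have "(1 - x) * (7 / 4 * (1 / (1 - x))) = 7 / 4"
        by (simp only: mult.left_commute[of "1 - x"] mult_1_right)
      then show ?thesis by (simp only: right_diff_distrib)
    qed
    also have "\<dots> \<le> (7 / 4 - \<delta> / 2) + L * (1 - x) - 7 / 4"
      using abel_mean_le[OF x wC W] b by (intro diff_right_mono) (simp add: \<delta>_def)
    finally show ?thesis by simp
  qed
  have "eventually (\<lambda>x. - (\<delta> / 4) < (1 - x) * (\<Sum>n. g n * x ^ n)) (at_left 1)"
    unfolding g_def using \<delta> by (intro mean_square_deviation_lower_bound[OF B]) auto
  moreover have "eventually (\<lambda>x. L * (1 - x) < \<delta> / 4) (at_left (1::real))"
  proof -
    have "((\<lambda>x. L * (1 - x)) \<longlongrightarrow> L * (1 - 1)) (at_left (1::real))" by (intro tendsto_intros)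
    then show ?thesis using \<delta> by (intro order_tendstoD(2)) auto
  qed
  moreover have "eventually (\<lambda>x. x \<in> {0<..<1}) (at_left (1::real))"
    by (rule eventually_at_leftI[of 0]) auto
  ultimately have "eventually (\<lambda>x. False) (at_left (1::real))"
  proof eventually_elim
    case (elim x)
    then show ?case using upper[of x] by auto
  qed
  then show False by simp
qed

end
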